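(* Let $d\in\mathbb{N}$ and let $\Delta$ be a pure $d$-dimensional simplicial complex on $n$ vertices with facet set $\mathcal{F}(\Delta)$. Then $\Delta$ is unit interval if and only if the following condition holds: there is a labelling of $V(\Delta)$ by $[n]$ such that for each facet $F=\{i_1,\dots,i_{d+1}\}$ with $i_1<\dots<i_{d+1}$ and each integer $j$ with $i_1\leq j\leq i_{d+1}$, $j\notin F$, if there exists a facet containing $j$ and $i_k$ for some $1\leq k\leq d+1$, then $\{i_1,\dots,\widehat{i_k},\dots,i_{d+1},j\}\in\mathcal{F}(\Delta)$. In particular, a simple graph $G$ is closed if and only if it is a proper interval graph.
   Context: A labelling of the vertex set of a simplicial complex on $n$ vertices is a bijection of the vertex set with $[n]$; vertices are identified with their labels. A pure $d$-dimensional simplicial complex $\Delta$ on $n$ vertices is called unit interval if there is a labelling of $V(\Delta)$ by $[n]$ such that for each facet $\{i_1,\dots,i_{d+1}\}$ with $i_1<\dots<i_{d+1}$, every set of integers $\{j_1,\dots,j_{d+1}\}$ with $i_1\leq j_1<\dots<j_{d+1}\leq i_{d+1}$ is a facet of $\Delta$. The notation $\widehat{i_k}$ means $i_k$ is omitted. A simple graph $G$ on $n$ vertices is closed if there is a labelling of $V(G)$ by $[n]$ such that whenever $ij,ik\in E(G)$ with $i<j<k$ then $jk\in E(G)$, and whenever $ij,kj\in E(G)$ with $i<k<j$ then $ik\in E(G)$. A graph is a proper interval graph if its vertices can be assigned nonempty intervals of the real line, none properly containing another, such that two vertices are adjacent exactly when their intervals intersect. *)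

theory Defs
  imports "HOL-Analysis.Analysis"
begin

definition vertices :: "'a set set \<Rightarrow> 'a set" where
  "vertices \<Delta> = \<Union>\<Delta>"

text \<open>Finite abstract simplicial complexes, given by their set of faces (the empty face included);
  every vertex is a face, since the vertex set is the union of the faces.\<close>

definition simplicial_cplx :: "'a set set \<Rightarrow> bool" where
  "simplicial_cplx \<Delta> \<longleftrightarrow>
     finite (vertices \<Delta>) \<and> {} \<in> \<Delta> \<and> (\<forall>F\<in>\<Delta>. \<forall>G. G \<subseteq> F \<longrightarrow> G \<in> \<Delta>)"

definition facets :: "'a set set \<Rightarrow> 'a set set" where
  "facets \<Delta> = {F \<in> \<Delta>. \<forall>G\<in>\<Delta>. F \<subseteq> G \<longrightarrow> G = F}"

definition face_dim :: "'a set \<Rightarrow> int" where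
  "face_dim F = int (card F) - 1"

definition cplx_dim :: "'a set set \<Rightarrow> int" where
  "cplx_dim \<Delta> = Max (face_dim ` \<Delta>)"

definition pure_cplx :: "'a set set \<Rightarrow> bool" where
  "pure_cplx \<Delta> \<longleftrightarrow> (\<forall>F\<in>facets \<Delta>. face_dim F = cplx_dim \<Delta>)"

text \<open>A labelling of a vertex set \<open>V\<close> is a bijection \<open>l\<close> from \<open>V\<close> onto \<open>{1..card V}\<close>.
  Identifying vertices with their labels turns a family of vertex sets (facets, edges) into a
  family of sets of natural numbers.\<close>

definition relabel :: "('a \<Rightarrow> nat) \<Rightarrow> 'a set set \<Rightarrow> nat set set" where
  "relabel l S = (\<lambda>F. l ` F) ` S"

text \<open>Facets are nonempty in the intended use (pure of dimension \<open>d \<ge> 0\<close>), so that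
  \<open>Min F\<close> and \<open>Max F\<close> are the least and the greatest label of the facet \<open>F\<close>.\<close>

definition unit_interval_cplx :: "nat \<Rightarrow> 'a set set \<Rightarrow> bool" where
  "unit_interval_cplx d \<Delta> \<longleftrightarrow>
     (\<exists>l. bij_betw l (vertices \<Delta>) {1..card (vertices \<Delta>)} \<and>
        (\<forall>F\<in>relabel l (facets \<Delta>). \<forall>J. card J = d + 1 \<and> J \<subseteq> {Min F..Max F}
            \<longrightarrow> J \<in> relabel l (facets \<Delta>)))"

definition simple_graph :: "'a set \<Rightarrow> 'a set set \<Rightarrow> bool" where
  "simple_graph V E \<longleftrightarrow> finite V \<and> (\<forall>e\<in>E. e \<subseteq> V \<and> card e = 2)"

definition closed_graph :: "'a set \<Rightarrow> 'a set set \<Rightarrow> bool" where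
  "closed_graph V E \<longleftrightarrow>
     (\<exists>l. bij_betw l V {1..card V} \<and>
        (\<forall>i j k. {i, j} \<in> relabel l E \<and> {i, k} \<in> relabel l E \<and> i < j \<and> j < k
            \<longrightarrow> {j, k} \<in> relabel l E) \<and>
        (\<forall>i j k. {i, j} \<in> relabel l E \<and> {k, j} \<in> relabel l E \<and> i < k \<and> k < j
            \<longrightarrow> {i, k} \<in> relabel l E))"

text \<open>The intervals may be open, closed, half-open, degenerate or unbounded, and distinct
  vertices may be assigned the same interval.\<close>

definition proper_interval_graph :: "'a set \<Rightarrow> 'a set set \<Rightarrow> bool" where
  "proper_interval_graph V E \<longleftrightarrow>
     (\<exists>I :: 'a \<Rightarrow> real set.
        (\<forall>v\<in>V. is_interval (I v) \<and> I v \<noteq> {}) \<and>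
        (\<forall>u\<in>V. \<forall>v\<in>V. \<not> I u \<subset> I v) \<and>
        (\<forall>u\<in>V. \<forall>v\<in>V. u \<noteq> v \<longrightarrow> ({u, v} \<in> E \<longleftrightarrow> I u \<inter> I v \<noteq> {})))"

end

theory Submission
  imports Defs
begin

text \<open>
  A unit interval labelling visibly has the exchange property. Conversely, given an exchange
  labelling, call two vertices adjacent if they share a facet. The larger neighbours of a vertex are
  pairwise adjacent, and so are the smaller ones; hence local extrema of a path can be short-cut and
  connected vertices are joined by a monotone path. It follows that a vertex lying in the range of a
  facet and in the connected component of that facet is adjacent to all of its vertices, so it can
  replace any of them; such replacements lead from the facet to every set of the same size in its
  range. Vertices of other components are moved out of the range by a new labelling that makes every
  component contiguous and keeps the order inside components.

  For graphs, closedness is the exchange property with \<open>d = 1\<close>. A unit interval labelling of a graph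
  yields proper intervals \<open>[i, r(i) + i/(n+1)]\<close>, where \<open>r(i)\<close> is the largest element among \<open>i\<close> and its neighbours; conversely,
  proper intervals are linearly ordered from left to right.
\<close>

section \<open>Monotone paths in an oriented adjacency relation\<close>

text \<open>Where a path turns, the two neighbours of the turning point are equal or comparable by
  \<open>inn\<close> or \<open>out\<close>, so the turning point can be skipped. The induction keeps
  the path built so far in one direction.\<close>

lemma rtrancl_sym_closure_monotone:
  assumes inn: "\<And>x y z. (x, z) \<in> U \<Longrightarrow> (y, z) \<in> U \<Longrightarrow> x = y \<or> (x, y) \<in> U \<or> (y, x) \<in> U"
    and out: "\<And>x y z. (x, y) \<in> U \<Longrightarrow> (x, z) \<in> U \<Longrightarrow> y = z \<or> (y, z) \<in> U \<or> (z, y) \<in> U"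
    and path: "(x, y) \<in> (U \<union> U\<inverse>)\<^sup>*"
  shows "(x, y) \<in> U\<^sup>* \<or> (y, x) \<in> U\<^sup>*"
proof -
  \<comment> \<open>Stated for arbitrary \<open>T\<close> so that it serves both \<open>U\<close>
    with \<open>inn\<close> and \<open>U\<inverse>\<close> with \<open>out\<close>. If
    \<open>w\<close> and \<open>z\<close> both point to \<open>y\<close>, comparing them either ends
    or extends the path at \<open>w\<close>, or moves the turn one step back.\<close>
  have shortcut: "(x, z) \<in> T\<^sup>* \<union> (T\<inverse>)\<^sup>*"
    if "(x, y) \<in> T\<^sup>*" "(z, y) \<in> T"
      and T: "\<And>x y z. (x, z) \<in> T \<Longrightarrow> (y, z) \<in> T \<Longrightarrow> x = y \<or> (x, y) \<in> T \<or> (y, x) \<in> T"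
    for T :: "('a \<times> 'a) set" and x y z
    using that(1,2)
  proof (induction arbitrary: z rule: rtrancl_induct)
    case base
    then show ?case by blast
  next
    case (step w y)
    from T[OF step.hyps(2) step.prems] show ?case
      using step by (meson UnI1 rtrancl.rtrancl_into_rtrancl)
  qed
  have "(x, y) \<in> U\<^sup>* \<union> (U\<inverse>)\<^sup>*"
    using path
  proof (induction rule: rtrancl_induct)
    case base
    then show ?case by blast
  next
    case (step y z)
    consider "(x, y) \<in> U\<^sup>*" "(y, z) \<in> U" | "(x, y) \<in> U\<^sup>*" "(z, y) \<in> U"
      | "(x, y) \<in> (U\<inverse>)\<^sup>*" "(y, z) \<in> U" | "(x, y) \<in> (U\<inverse>)\<^sup>*" "(y, z) \<in> U\<inverse>"
      using step by blast
    then show ?case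
    proof cases
      case 1
      then show ?thesis by (meson UnI1 rtrancl.rtrancl_into_rtrancl)
    next
      case 2
      show ?thesis by (rule shortcut[OF 2]) (use inn in blast)
    next
      case 3
      have "(x, z) \<in> (U\<inverse>)\<^sup>* \<union> ((U\<inverse>)\<inverse>)\<^sup>*"
        by (rule shortcut[OF 3(1)]) (use 3 out in blast)+
      then show ?thesis by auto
    next
      case 4
      then show ?thesis by (meson UnI2 rtrancl.rtrancl_into_rtrancl)
    qed
  qed
  then show ?thesis
    by (auto simp: rtrancl_converse)
qed

text \<open>The path from \<open>u\<close> to \<open>j\<close> can be taken increasing. Along it
  every vertex stays adjacent to \<open>v\<close> by \<open>out\<close>; finally \<open>inn\<close>
  at \<open>v\<close> makes \<open>u\<close> and \<open>j\<close> adjacent.\<close>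

lemma connected_between_adjacent:
  fixes U :: "('a::linorder \<times> 'a) set"
  assumes less: "\<And>x y. (x, y) \<in> U \<Longrightarrow> x < y"
    and inn: "\<And>x y z. (x, z) \<in> U \<Longrightarrow> (y, z) \<in> U \<Longrightarrow> x = y \<or> (x, y) \<in> U \<or> (y, x) \<in> U"
    and out: "\<And>x y z. (x, y) \<in> U \<Longrightarrow> (x, z) \<in> U \<Longrightarrow> y = z \<or> (y, z) \<in> U \<or> (z, y) \<in> U"
    and uv: "(u, v) \<in> U" and conn: "(u, j) \<in> (U \<union> U\<inverse>)\<^sup>*" and "u < j" "j < v"
  shows "(u, j) \<in> U" "(j, v) \<in> U"
proof -
  have le: "x \<le> y" if "(x, y) \<in> U\<^sup>*" for x y
    using that by (induction rule: rtrancl_induct) (auto dest: less)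
  \<comment> \<open>The alternative \<open>(j, u) \<in> U\<^sup>*\<close> would force
    \<open>j \<le> u\<close>.\<close>
  have "(u, j) \<in> U\<^sup>*"
    using rtrancl_sym_closure_monotone[OF inn out conn] le \<open>u < j\<close> by fastforce
  then show jv: "(j, v) \<in> U"
    using \<open>j < v\<close>
  proof (induction rule: rtrancl_induct)
    case base
    then show ?case using uv by simp
  next
    case (step p q)
    have "(p, v) \<in> U"
      using step less[OF step.hyps(2)] by auto
    from out[OF step.hyps(2) this] show ?case
      using step.prems less by force
  qed
  show "(u, j) \<in> U"
    using inn[OF uv jv] less \<open>u < j\<close> by force
qed

section \<open>Reaching a set in the range of a facet by exchanges\<close>

text \<open>Each exchange trades an element outside \<open>J\<close> for one of \<open>J\<close>, so
  \<open>card (J - F)\<close> drops. The trade must be chosen so that \<open>J\<close> stays within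
  the range of the new set.\<close>

lemma exchange_into_range:
  fixes T :: "nat set set"
  assumes card: "\<And>F. F \<in> T \<Longrightarrow> card F = Suc d"
    and swap: "\<And>F x i. F \<in> T \<Longrightarrow> x \<in> J \<Longrightarrow> x \<notin> F \<Longrightarrow> Min F \<le> x \<Longrightarrow> x \<le> Max F \<Longrightarrow> i \<in> F
                 \<Longrightarrow> insert x (F - {i}) \<in> T"
    and J: "card J = Suc d"
    and "F \<in> T" "J \<subseteq> {Min F..Max F}"
  shows "J \<in> T"
  using assms(4,5)
proof (induction "card (J - F)" arbitrary: F rule: less_induct)
  case less
  have finF: "finite F" "F \<noteq> {}"
    using card[OF less.prems(1)] by (auto intro: card_ge_0_finite)
  have finJ: "finite J" "J \<noteq> {}"
    using J by (auto intro: card_ge_0_finite)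
  show ?case
  proof (cases "J \<subseteq> F")
    case True
    then have "J = F"
      using J card[OF less.prems(1)] finF by (metis card_subset_eq)
    then show ?thesis using less.prems by simp
  next
    case False
    then obtain x0 where x0: "x0 \<in> J" "x0 \<notin> F" by blast
    have "\<not> F \<subseteq> J"
      using J card[OF less.prems(1)] finJ False by (metis card_subset_eq order_refl)
    then obtain i0 where i0: "i0 \<in> F" "i0 \<notin> J" by blast
    have mem: "Min F \<in> F" "Max F \<in> F" "Min J \<in> J" "Max J \<in> J"
      using finF finJ by auto
    have x0_bounds: "Min F < x0" "x0 < Max F"
      using less.prems x0 mem by (auto simp: order_less_le)
    have rng: "Min F \<le> Min J" "Max J \<le> Max F"
      using less.prems mem by auto
    \<comment> \<open>The witnesses \<open>a\<close> and \<open>b\<close> show that the new range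
      still covers \<open>J\<close>. An end of \<open>F\<close> outside \<open>J\<close> is removed
      first, with the corresponding end of \<open>J\<close> put in unless it is already there; if
      both ends lie in \<open>J\<close>, they survive any exchange.\<close>
    obtain i x a b where ix: "i \<in> F" "i \<notin> J" "x \<in> J" "x \<notin> F"
      and ab: "a \<in> insert x (F - {i})" "a \<le> Min J" "b \<in> insert x (F - {i})" "Max J \<le> b"
    proof -
      consider "Min F \<notin> J" | "Max F \<notin> J" | "Min F \<in> J" "Max F \<in> J" by blast
      then show ?thesis
      proof cases
        case 1
        show ?thesis
          by (rule that[of "Min F" "if Min J \<in> F then x0 else Min J" "Min J" "Max F"])
            (use 1 x0 x0_bounds mem rng in \<open>auto split: if_splits\<close>)
      next
        case 2
        show ?thesis
          by (rule that[of "Max F" "if Max J \<in> F then x0 else Max J" "Min F" "Max J"])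
            (use 2 x0 x0_bounds mem rng in \<open>auto split: if_splits\<close>)
      next
        case 3
        show ?thesis
          by (rule that[of i0 x0 "Min F" "Max F"]) (use 3 i0 x0 mem rng in auto)
      qed
    qed
    let ?F = "insert x (F - {i})"
    have "Min F \<le> x" "x \<le> Max F"
      using less.prems ix by auto
    then have F': "?F \<in> T"
      using swap less.prems(1) ix by blast
    have "Min ?F \<le> a" "b \<le> Max ?F"
      using ab finF by (auto intro!: Min_le Max_ge)
    then have "J \<subseteq> {Min ?F..Max ?F}"
      using ab finJ by (meson Max_ge Min_le atLeastAtMost_iff order_trans subsetI)
    moreover have "card (J - ?F) < card (J - F)"
      using ix finJ by (intro psubset_card_mono) auto
    ultimately show ?thesis
      using less.hyps F' by blast
  qed
qed

section \<open>Labellings and relabelled families\<close>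

text \<open>Sort \<open>V\<close> by \<open>f\<close> and number the positions from 1. The key may
  have ties, which are broken arbitrarily.\<close>

lemma labelling_mono_key:
  fixes f :: "'a \<Rightarrow> 'b::linorder"
  assumes "finite V"
  obtains l where "bij_betw l V {1..card V}" "\<And>x y. x \<in> V \<Longrightarrow> y \<in> V \<Longrightarrow> l x \<le> l y \<Longrightarrow> f x \<le> f y"
proof -
  obtain xs where xs: "set xs = V" "distinct xs"
    using finite_distinct_list assms by blast
  define ys where "ys = sort_key f xs"
  have ys: "set ys = V" "distinct ys" "sorted (map f ys)" "length ys = card V"
    using xs distinct_card[of xs] by (auto simp: ys_def)
  have "bij_betw ((!) ys) {..<card V} V"
    using bij_betw_nth[OF ys(2)] ys by simp
  then have inv: "bij_betw (inv_into {..<card V} ((!) ys)) V {..<card V}" (is "bij_betw ?g _ _")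
    by (rule bij_betw_inv_into)
  have nth: "ys ! ?g x = x" if "x \<in> V" for x
    using \<open>bij_betw ((!) ys) {..<card V} V\<close> that by (auto simp: bij_betw_inv_into_right)
  have lt: "?g x < card V" if "x \<in> V" for x
    using inv that by (auto simp: bij_betw_def)
  have "bij_betw Suc {..<card V} {1..card V}"
    by (simp add: bij_betw_def lessThan_atLeast0 image_Suc_atLeastLessThan atLeastLessThanSuc_atLeastAtMost)
  then have bij: "bij_betw (Suc \<circ> ?g) V {1..card V}"
    using inv bij_betw_trans by blast
  have "f x \<le> f y" if "x \<in> V" "y \<in> V" "(Suc \<circ> ?g) x \<le> (Suc \<circ> ?g) y" for x y
  proof -
    have "map f ys ! ?g x \<le> map f ys ! ?g y"
      using that ys lt by (intro sorted_nth_mono) auto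
    then show ?thesis using that nth lt ys by simp
  qed
  with bij show thesis by (rule that)
qed

lemma image_mem_relabel_iff:
  assumes "inj_on l V" "S \<subseteq> Pow V" "F \<subseteq> V"
  shows "l ` F \<in> relabel l S \<longleftrightarrow> F \<in> S"
  using assms by (auto simp: relabel_def inj_on_image_eq_iff subset_iff image_iff)

lemma relabel_comp: "relabel (g \<circ> l) S = relabel g (relabel l S)"
  by (simp add: relabel_def image_image)

section \<open>From the exchange property to unit intervals\<close>

text \<open>A new labelling is unavoidable: for \<open>d = 1\<close> the edges {1,3} and {2,4} have
  the exchange property, but {1,2} is missing. Components may interleave, and \<open>g\<close>
  separates them.\<close>

lemma exchange_imp_interval_relabelling:
  fixes V :: "nat set" and S :: "nat set set"
  assumes "finite V" and S: "S \<subseteq> Pow V" and card: "\<And>F. F \<in> S \<Longrightarrow> card F = d + 1"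
    and exch: "\<And>F H i j. F \<in> S \<Longrightarrow> H \<in> S \<Longrightarrow> Min F \<le> j \<Longrightarrow> j \<le> Max F \<Longrightarrow> j \<notin> F \<Longrightarrow> i \<in> F
                 \<Longrightarrow> j \<in> H \<Longrightarrow> i \<in> H \<Longrightarrow> insert j (F - {i}) \<in> S"
  obtains g where "bij_betw g V {1..card V}"
    "\<And>F J. F \<in> relabel g S \<Longrightarrow> card J = d + 1 \<Longrightarrow> J \<subseteq> {Min F..Max F} \<Longrightarrow> J \<in> relabel g S"
proof -
  have finS: "finite F" "F \<noteq> {}" if "F \<in> S" for F
    using card[OF that] by (auto intro: card_ge_0_finite)
  define U where "U = {(u, v). u < v \<and> (\<exists>H\<in>S. u \<in> H \<and> v \<in> H)}"
  define K where "K = (U \<union> U\<inverse>)\<^sup>*"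
  have less: "x < y" if "(x, y) \<in> U" for x y
    using that by (simp add: U_def)
  have U_if: "(x, y) \<in> U" if "F \<in> S" "x \<in> F" "y \<in> F" "x < y" for F x y
    using that by (auto simp: U_def)
  \<comment> \<open>In a facet through \<open>x\<close> and \<open>y\<close>, exchanging one of them
    for \<open>j\<close> leaves a facet through \<open>j\<close> and the other.\<close>
  have adj: "(x, j) \<in> U \<longleftrightarrow> (j, y) \<in> U" if "(x, y) \<in> U" "x < j" "j < y" for x j y
  proof -
    from that(1) obtain F where F: "F \<in> S" "x \<in> F" "y \<in> F" by (auto simp: U_def)
    have rng: "Min F \<le> j" "j \<le> Max F"
      using F that finS[OF F(1)] by (meson Min_le Max_ge less_imp_le order_trans)+
    show ?thesis
    proof (cases "j \<in> F")
      case True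
      then show ?thesis using U_if F that by blast
    next
      case False
      show ?thesis
      proof
        assume "(x, j) \<in> U"
        then obtain H where "H \<in> S" "x \<in> H" "j \<in> H" by (auto simp: U_def)
        then have "insert j (F - {x}) \<in> S" using exch F rng False by blast
        then show "(j, y) \<in> U" by (rule U_if) (use F that in auto)
      next
        assume "(j, y) \<in> U"
        then obtain H where "H \<in> S" "y \<in> H" "j \<in> H" by (auto simp: U_def)
        then have "insert j (F - {y}) \<in> S" using exch F rng False by blast
        then show "(x, j) \<in> U" by (rule U_if) (use F that in auto)
      qed
    qed
  qed
  have inn: "x = y \<or> (x, y) \<in> U \<or> (y, x) \<in> U" if "(x, z) \<in> U" "(y, z) \<in> U" for x y z
    using that adj[of x z y] adj[of y z x] less by (metis linorder_neqE_nat)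
  have out: "y = z \<or> (y, z) \<in> U \<or> (z, y) \<in> U" if "(x, y) \<in> U" "(x, z) \<in> U" for x y z
    using that adj[of x z y] adj[of x y z] less by (metis linorder_neqE_nat)
  have symK: "(y, x) \<in> K" if "(x, y) \<in> K" for x y
    using that unfolding K_def by (metis converse_Un converse_converse rtrancl_converseD sup_commute)
  have transK: "(x, z) \<in> K" if "(x, y) \<in> K" "(y, z) \<in> K" for x y z
    using that unfolding K_def by (rule rtrancl_trans)
  have facetK: "(x, y) \<in> K" if "F \<in> S" "x \<in> F" "y \<in> F" for F x y
    using U_if[OF that] U_if[OF that(1,3,2)] unfolding K_def
    by (metis UnI1 UnI2 converse_iff linorder_neqE_nat r_into_rtrancl rtrancl.rtrancl_refl)

  have swap: "insert x (F - {i}) \<in> S"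
    if F: "F \<in> S" and x: "x \<notin> F" "Min F \<le> x" "x \<le> Max F" "(Min F, x) \<in> K" and i: "i \<in> F" for F x i
  proof -
    have mem: "Min F \<in> F" "Max F \<in> F" using finS[OF F] by auto
    have lt: "Min F < x" "x < Max F" using x mem by (auto simp: order_less_le)
    have ends: "(Min F, Max F) \<in> U" using U_if[OF F mem] lt by simp
    have "(Min F, x) \<in> U" "(x, Max F) \<in> U"
      using connected_between_adjacent[OF less inn out ends _ lt] x(4) unfolding K_def by auto
    then obtain H1 H2 where H: "H1 \<in> S" "Min F \<in> H1" "x \<in> H1" "H2 \<in> S" "Max F \<in> H2" "x \<in> H2"
      by (auto simp: U_def)
    \<comment> \<open>This facet contains \<open>x\<close> and every element of \<open>F\<close>
      other than \<open>Min F\<close>, so it is the common facet that \<open>exch\<close> asks for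
      when another \<open>i\<close> is replaced.\<close>
    have swap_min: "insert x (F - {Min F}) \<in> S"
      using exch F H x mem by blast
    show ?thesis
    proof (cases "i = Min F")
      case True
      then show ?thesis using swap_min by simp
    next
      case False
      then show ?thesis using exch[OF F swap_min x(2,3,1) i] i by simp
    qed
  qed

  \<comment> \<open>The least element names the component; it exists since \<open>K\<close> is
    reflexive.\<close>
  define rep where "rep x = (LEAST y. (x, y) \<in> K)" for x
  have rep_mem: "(x, rep x) \<in> K" for x
    unfolding rep_def by (rule LeastI[of _ x]) (simp add: K_def)
  have rep_eq: "rep x = rep y" if "(x, y) \<in> K" for x y
    unfolding rep_def using that symK transK by metis
  have rep_eqD: "(x, y) \<in> K" if "rep x = rep y" for x y
    using rep_mem[of x] rep_mem[of y] symK transK that by metis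
  \<comment> \<open>\<open>M\<close> exceeds every label, so \<open>rep x * M + x\<close> encodes
    the lexicographic order on the pairs of \<open>rep x\<close> and \<open>x\<close>, and division
    by \<open>M\<close> recovers \<open>rep x\<close>.\<close>
  define M where "M = Suc (Max V)"
  have ltM: "x < M" if "x \<in> V" for x
    using that \<open>finite V\<close> by (simp add: M_def less_Suc_eq_le)
  obtain g where g: "bij_betw g V {1..card V}"
    and mono: "\<And>x y. x \<in> V \<Longrightarrow> y \<in> V \<Longrightarrow> g x \<le> g y \<Longrightarrow> rep x * M + x \<le> rep y * M + y"
    using labelling_mono_key[OF \<open>finite V\<close>, of "\<lambda>x. rep x * M + x"] by blast
  have mono_rep: "rep x \<le> rep y" if "x \<in> V" "y \<in> V" "g x \<le> g y" for x y
  proof -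
    have "(rep x * M + x) div M \<le> (rep y * M + y) div M"
      using mono[OF that] by (rule div_le_mono)
    then show ?thesis using ltM[OF that(1)] ltM[OF that(2)] by simp
  qed
  have injg: "inj_on g V" using g by (simp add: bij_betw_def)
  have "g ` J \<in> relabel g S"
    if F: "F \<in> S" and J: "J \<subseteq> V" "card J = d + 1" "g ` J \<subseteq> {Min (g ` F)..Max (g ` F)}" for F J
  proof -
    have FV: "F \<subseteq> V" using S F by auto
    have mem: "Min F \<in> F" using finS[OF F] by auto
    \<comment> \<open>The elements \<open>a\<close> and \<open>b\<close> of \<open>F\<close> with
      extreme new labels lie in one component. Since \<open>g x\<close> is between theirs,
      \<open>rep x\<close> is squeezed to the same value, and then the old label \<open>x\<close>
      lies between \<open>a\<close> and \<open>b\<close>.\<close>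
    have J_range: "(Min F, x) \<in> K \<and> Min F \<le> x \<and> x \<le> Max F" if "x \<in> J" for x
    proof -
      have "Min (g ` F) \<in> g ` F" "Max (g ` F) \<in> g ` F"
        using finS[OF F] by (auto intro!: Min_in Max_in simp del: Min_in Max_in)
      then obtain a b where ab: "a \<in> F" "b \<in> F" "g a = Min (g ` F)" "g b = Max (g ` F)"
        by (metis imageE)
      then have le: "g a \<le> g x" "g x \<le> g b" using J(3) that by auto
      have inV: "a \<in> V" "b \<in> V" "x \<in> V" using ab FV J that by auto
      have "rep a = rep b" using rep_eq facetK F ab by blast
      then have eq: "rep x = rep a" using mono_rep le inV by (metis order_antisym)
      have "a \<le> x" "x \<le> b"
        using mono[OF _ _ le(1)] mono[OF _ _ le(2)] inV eq \<open>rep a = rep b\<close> by auto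
      then have "Min F \<le> x" "x \<le> Max F"
        using ab finS[OF F] by (meson Min_le Max_ge order_trans)+
      moreover have "(Min F, x) \<in> K"
        using transK[OF facetK[OF F mem ab(1)] rep_eqD] eq by simp
      ultimately show ?thesis by blast
    qed
    \<comment> \<open>Restricting to facets in the component of \<open>F\<close> supplies the
      connectivity that \<open>swap\<close> requires after every exchange.\<close>
    define T where "T = {H \<in> S. \<forall>y\<in>H. (Min F, y) \<in> K}"
    have "J \<in> T"
    proof (rule exchange_into_range[where F = F and d = d])
      show "F \<in> T" using F facetK mem by (auto simp: T_def)
      show "J \<subseteq> {Min F..Max F}" using J_range by auto
      fix H x i
      assume H: "H \<in> T" and x: "x \<in> J" "x \<notin> H" "Min H \<le> x" "x \<le> Max H" and i: "i \<in> H"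
      then have "(Min F, Min H) \<in> K"
        using finS[of H] by (auto simp: T_def)
      then have "(Min H, x) \<in> K" using J_range[OF x(1)] symK transK by blast
      then show "insert x (H - {i}) \<in> T"
        using swap[of H x i] H x i J_range by (auto simp: T_def)
    qed (use J card in \<open>auto simp: T_def\<close>)
    then show ?thesis by (auto simp: T_def relabel_def)
  qed
  note interval = this
  have "J \<in> relabel g S"
    if "F \<in> relabel g S" "card J = d + 1" "J \<subseteq> {Min F..Max F}" for F J
  proof -
    from that(1) obtain F0 where F0: "F0 \<in> S" "F = g ` F0" by (auto simp: relabel_def)
    have "g ` F0 \<subseteq> {1..card V}" using S F0 g by (auto simp: bij_betw_def)
    moreover have "Min F \<in> F" "Max F \<in> F" using F0 finS[OF F0(1)] by auto
    ultimately have "J \<subseteq> g ` V"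
      using that(3) g F0(2) by (fastforce simp: bij_betw_def)
    then obtain J0 where J0: "J0 \<subseteq> V" "J = g ` J0" by (meson subset_imageE)
    have "card J0 = card J" using J0 injg by (metis card_image inj_on_subset)
    then show ?thesis using interval[OF F0(1) J0(1)] that J0 F0 by simp
  qed
  with g show thesis by (rule that)
qed

section \<open>Closed graphs and proper interval graphs\<close>

text \<open>After relabelling, every pair within the range of an edge is an edge. Adjacency to
  larger labels is then governed by the furthest one, which determines where an interval must
  end.\<close>

lemma closed_imp_proper_interval:
  assumes G: "simple_graph V E" and "closed_graph V E"
  shows "proper_interval_graph V E"
proof -
  have "finite V" and E: "E \<subseteq> Pow V" and card2: "\<And>e. e \<in> E \<Longrightarrow> card e = 2"
    using G by (auto simp: simple_graph_def)
  obtain l where l: "bij_betw l V {1..card V}"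
    and up: "\<And>i j k. {i, j} \<in> relabel l E \<Longrightarrow> {i, k} \<in> relabel l E \<Longrightarrow> i < j \<Longrightarrow> j < k \<Longrightarrow> {j, k} \<in> relabel l E"
    and down: "\<And>i j k. {i, j} \<in> relabel l E \<Longrightarrow> {k, j} \<in> relabel l E \<Longrightarrow> i < k \<Longrightarrow> k < j \<Longrightarrow> {i, k} \<in> relabel l E"
    using assms(2) unfolding closed_graph_def by blast
  define S where "S = relabel l E"
  have S: "S \<subseteq> Pow {1..card V}"
    using E l by (fastforce simp: S_def relabel_def bij_betw_def)
  have S2: "card e = 2" if "e \<in> S" for e
    using that card2 E l by (auto simp: S_def relabel_def bij_betw_def subset_iff card_image inj_on_subset)
  \<comment> \<open>A common edge of \<open>i\<close> and \<open>j\<close> is \<open>{i, j}\<close>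
    itself. Replacing the smaller end of \<open>F\<close> is then the condition \<open>up\<close>,
    replacing the larger end is \<open>down\<close>.\<close>
  have exch: "insert j (F - {i}) \<in> S"
    if F: "F \<in> S" "Min F \<le> j" "j \<le> Max F" "j \<notin> F" "i \<in> F" and H: "H \<in> S" "j \<in> H" "i \<in> H" for F H i j
  proof -
    obtain a b where ab: "F = {a, b}" "a < b"
      using S2[OF F(1)] by (metis card_2_iff insert_commute linorder_neqE_nat)
    then have lt: "a < j" "j < b" using F by (auto simp: order_less_le)
    have "i \<noteq> j" using F by auto
    have "card {i, j} = card H" using S2[OF H(1)] \<open>i \<noteq> j\<close> by simp
    moreover have "finite H" using S2[OF H(1)] by (intro card_ge_0_finite) simp
    ultimately have "{i, j} = H" using H by (intro card_subset_eq) auto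
    then have ij: "{i, j} \<in> S" using H by simp
    show ?thesis
    proof (cases "i = a")
      case True
      then have "insert j (F - {i}) = {j, b}" using ab by auto
      then show ?thesis using up[of a j b] ij F ab lt True by (simp add: S_def)
    next
      case False
      then have "i = b" "insert j (F - {i}) = {a, j}" using ab F by auto
      then show ?thesis using down[of a b j] ij F ab lt by (simp add: S_def insert_commute)
    qed
  qed
  obtain g where g: "bij_betw g {1..card V} {1..card {1..card V}}"
    and int: "\<And>F J. F \<in> relabel g S \<Longrightarrow> card J = 1 + 1 \<Longrightarrow> J \<subseteq> {Min F..Max F} \<Longrightarrow> J \<in> relabel g S"
    using exchange_imp_interval_relabelling[of "{1..card V}" S 1] S S2 exch
    by (metis finite_atLeastAtMost one_add_one)
  define m where "m = g \<circ> l"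
  have m: "bij_betw m V {1..card V}"
    using bij_betw_trans[OF l g] by (simp add: m_def)
  then have injm: "inj_on m V" by (simp add: bij_betw_def)
  define A where "A i j \<longleftrightarrow> {i, j} \<in> relabel m E" for i j
  have A_iff: "A (m u) (m v) \<longleftrightarrow> {u, v} \<in> E" if "u \<in> V" "v \<in> V" for u v
    using image_mem_relabel_iff[OF injm E, of "{u, v}"] that by (simp add: A_def)
  have A_le: "j \<le> card V" if "A i j" for i j
  proof -
    have "{i, j} \<subseteq> m ` V" using that E by (fastforce simp: A_def relabel_def)
    then show ?thesis using m by (auto simp: bij_betw_def)
  qed
  have A_sym: "A i j \<longleftrightarrow> A j i" for i j by (simp add: A_def insert_commute)
  have A_int: "A a b" if "A i k" "i \<le> a" "a < b" "b \<le> k" for a b i k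
    using int[of "{i, k}" "{a, b}"] that by (simp add: A_def m_def S_def relabel_comp)
  \<comment> \<open>Inserting \<open>i\<close> gives \<open>r i = i\<close> when no larger label is
    adjacent to \<open>i\<close>.\<close>
  define r where "r i = Max (insert i {j. A i j})" for i
  have fin: "finite (insert i {j. A i j})" for i
    using A_le by (auto intro: finite_subset[of _ "{..card V}"])
  have r_ge: "i \<le> r i" for i
    unfolding r_def by (rule Max_ge[OF fin]) simp
  have r_A: "A i j \<longleftrightarrow> j \<le> r i" if "i < j" for i j
  proof
    show "A i j \<Longrightarrow> j \<le> r i"
      unfolding r_def by (rule Max_ge[OF fin]) simp
    assume "j \<le> r i"
    moreover have "r i \<in> insert i {j. A i j}"
      unfolding r_def by (rule Max_in[OF fin]) simp
    ultimately show "A i j" using A_int[of i "r i" i j] that by auto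
  qed
  have r_mono: "r i \<le> r j" if "i < j" for i j
  proof (cases "r i \<le> j")
    case True
    then show ?thesis using r_ge[of j] by simp
  next
    case False
    then have "A i (r i)" using r_A that by auto
    then have "A j (r i)" using A_int[of i "r i" j "r i"] that False by simp
    then show ?thesis using r_A False by auto
  qed
  \<comment> \<open>\<open>r\<close> is only weakly increasing. The added fraction makes the right
    ends strictly increasing and, being below 1, reaches no further integer.\<close>
  define R where "R i = real (r i) + real i / (real (card V) + 1)" for i
  have R_mono: "R i < R j" if "i < j" for i j
    using r_mono[OF that] that unfolding R_def
    by (intro add_le_less_mono divide_strict_right_mono) auto
  have R_ge: "real i \<le> R i" for i
  proof -
    have "real i \<le> real (r i)" using r_ge by simp
    also have "\<dots> \<le> R i" by (simp add: R_def)
    finally show ?thesis .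
  qed
  have R_iff: "real j \<le> R i \<longleftrightarrow> j \<le> r i" if "i \<le> card V" for i j
  proof
    assume "real j \<le> R i"
    moreover have "real i / (real (card V) + 1) < 1" using that by simp
    ultimately have "real j < real (r i) + 1" unfolding R_def by linarith
    then show "j \<le> r i" by linarith
  next
    assume "j \<le> r i"
    then have "real j \<le> real (r i)" by simp
    also have "\<dots> \<le> R i" by (simp add: R_def)
    finally show "real j \<le> R i" .
  qed
  define I where "I v = {real (m v)..R (m v)}" for v
  have m_le: "m v \<le> card V" if "v \<in> V" for v
    using m that by (auto simp: bij_betw_def)
  have meet: "{u, v} \<in> E \<longleftrightarrow> I u \<inter> I v \<noteq> {}" if "u \<in> V" "v \<in> V" "m u < m v" for u v
  proof -
    \<comment> \<open>\<open>I v\<close> both starts and ends after \<open>I u\<close>, so they meet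
      exactly when \<open>I u\<close> reaches the left end of \<open>I v\<close>.\<close>
    have "I u \<inter> I v \<noteq> {} \<longleftrightarrow> real (m v) \<le> R (m u)"
      using that R_ge R_mono[OF that(3)] by (auto simp: I_def)
    then show ?thesis
      using A_iff r_A R_iff m_le that by metis
  qed
  have "{u, v} \<in> E \<longleftrightarrow> I u \<inter> I v \<noteq> {}" if "u \<in> V" "v \<in> V" "u \<noteq> v" for u v
  proof (cases "m u < m v")
    case True
    then show ?thesis using meet that by blast
  next
    case False
    then have "m v < m u" using that injm by (metis inj_onD linorder_neqE_nat)
    then show ?thesis using meet[of v u] that by (simp add: insert_commute Int_commute)
  qed
  moreover have "\<not> I u \<subset> I v" if "u \<in> V" "v \<in> V" for u v
  proof
    assume sub: "I u \<subset> I v"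
    \<comment> \<open>Left and right ends increase together, so containment forces equal
      labels.\<close>
    then have le: "m v \<le> m u" "R (m u) \<le> R (m v)"
      using R_ge[of "m u"] by (auto simp: I_def)
    then have "m u = m v" using R_mono[of "m v" "m u"] by linarith
    then show False using sub by (simp add: I_def)
  qed
  moreover have "is_interval (I v) \<and> I v \<noteq> {}" for v
    using R_ge by (auto simp: I_def is_interval_cc)
  ultimately show ?thesis
    unfolding proper_interval_graph_def by blast
qed

text \<open>When no interval properly contains another, the orders by left and by right ends agree.
  A point common to two intervals then lies in every interval between them.\<close>

lemma proper_interval_imp_closed:
  assumes G: "simple_graph V E" and "proper_interval_graph V E"
  shows "closed_graph V E"
proof -
  have "finite V" and E: "E \<subseteq> Pow V"
    using G by (auto simp: simple_graph_def)
  obtain I :: "'a \<Rightarrow> real set" where "(\<forall>v\<in>V. is_interval (I v) \<and> I v \<noteq> {}) \<and>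
      (\<forall>u\<in>V. \<forall>v\<in>V. \<not> I u \<subset> I v) \<and>
      (\<forall>u\<in>V. \<forall>v\<in>V. u \<noteq> v \<longrightarrow> ({u, v} \<in> E \<longleftrightarrow> I u \<inter> I v \<noteq> {}))"
    using assms(2) unfolding proper_interval_graph_def by (rule exE)
  then have int: "\<And>v. v \<in> V \<Longrightarrow> is_interval (I v)"
    and proper: "\<And>u v. u \<in> V \<Longrightarrow> v \<in> V \<Longrightarrow> \<not> I u \<subset> I v"
    and meet: "\<And>u v. u \<in> V \<Longrightarrow> v \<in> V \<Longrightarrow> u \<noteq> v \<Longrightarrow> {u, v} \<in> E \<longleftrightarrow> I u \<inter> I v \<noteq> {}"
    by auto
  \<comment> \<open>\<open>D v\<close> and \<open>P v\<close> are the down-closure and up-closure of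
    \<open>I v\<close>. They stand for the right and left end, so open, closed and infinite ends
    need no case distinction.\<close>
  define D where "D v = {x. \<exists>y\<in>I v. x \<le> y}" for v
  define P where "P v = {x. \<exists>y\<in>I v. y \<le> x}" for v
  have I_eq: "I v = D v \<inter> P v" if "v \<in> V" for v
    using int[OF that] unfolding D_def P_def is_interval_1 by auto
  have D_lin: "D u \<subseteq> D v \<or> D v \<subseteq> D u" for u v
    unfolding D_def by (smt (verit) mem_Collect_eq subsetI order_trans linear)
  have P_lin: "P u \<subseteq> P v \<or> P v \<subseteq> P u" for u v
    unfolding P_def by (smt (verit) mem_Collect_eq subsetI order_trans linear)
  have DP: "P v \<subseteq> P u" if "u \<in> V" "v \<in> V" "D u \<subseteq> D v" for u v
  proof (rule ccontr)
    assume not: "\<not> P v \<subseteq> P u"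
    then have "P u \<subseteq> P v" using P_lin by blast
    then have "I u \<subseteq> I v" using I_eq that by blast
    then have "I u = I v" using proper that by blast
    then show False using not by (simp add: P_def)
  qed
  \<comment> \<open>The sets \<open>D v\<close> are linearly ordered by inclusion; \<open>f\<close>
    turns this order into a numeric rank usable as a sorting key.\<close>
  define f where "f v = card {w \<in> V. D w \<subseteq> D v}" for v
  obtain l where l: "bij_betw l V {1..card V}"
    and mono: "\<And>u v. u \<in> V \<Longrightarrow> v \<in> V \<Longrightarrow> l u \<le> l v \<Longrightarrow> f u \<le> f v"
    using labelling_mono_key[OF \<open>finite V\<close>, of f] by blast
  have mono_D: "D u \<subseteq> D v" if "u \<in> V" "v \<in> V" "l u \<le> l v" for u v
  proof (rule ccontr)
    assume not: "\<not> D u \<subseteq> D v"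
    then have "D v \<subseteq> D u" using D_lin by blast
    then have "{w \<in> V. D w \<subseteq> D v} \<subset> {w \<in> V. D w \<subseteq> D u}" using not that by blast
    then have "f v < f u" unfolding f_def using \<open>finite V\<close> by (intro psubset_card_mono) auto
    then show False using mono[OF that] by simp
  qed
  have injl: "inj_on l V" using l by (simp add: bij_betw_def)
  have between: "{u, w} \<in> E \<and> {w, v} \<in> E"
    if "u \<in> V" "v \<in> V" "w \<in> V" "{u, v} \<in> E" "l u < l w" "l w < l v" for u v w
  proof -
    have "u \<noteq> v" "u \<noteq> w" "w \<noteq> v" using that by auto
    then have "I u \<inter> I v \<noteq> {}" using meet that by blast
    then obtain x where x: "x \<in> I u" "x \<in> I v" by blast
    have "x \<in> D w" using x I_eq mono_D[of u w] that by auto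
    moreover have "x \<in> P w" using x I_eq DP[OF _ _ mono_D[of w v]] that by auto
    ultimately have "x \<in> I w" using I_eq that by simp
    then show ?thesis using x meet that \<open>u \<noteq> w\<close> \<open>w \<noteq> v\<close> by blast
  qed
  have label: "\<exists>u\<in>V. \<exists>v\<in>V. i = l u \<and> j = l v" if "{i, j} \<in> relabel l E" for i j
    using that E unfolding relabel_def by (auto simp: set_eq_iff) (metis PowD imageE insertCI subsetD)+
  have edge: "{l u, l v} \<in> relabel l E \<longleftrightarrow> {u, v} \<in> E" if "u \<in> V" "v \<in> V" for u v
    using image_mem_relabel_iff[OF injl E, of "{u, v}"] that by simp
  \<comment> \<open>In each closedness condition one edge spans the third label, and
    \<open>between\<close> applies to it.\<close>
  have "{j, k} \<in> relabel l E"
    if "{i, j} \<in> relabel l E" "{i, k} \<in> relabel l E" "i < j" "j < k" for i j k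
    using label[OF that(1)] label[OF that(2)] that edge between by (metis injl inj_onD)
  moreover have "{i, k} \<in> relabel l E"
    if "{i, j} \<in> relabel l E" "{k, j} \<in> relabel l E" "i < k" "k < j" for i j k
    using label[OF that(1)] label[OF that(2)] that edge between by (metis injl inj_onD)
  ultimately show ?thesis
    unfolding closed_graph_def using l by blast
qed

section \<open>Assembling the two equivalences\<close>

lemma facets_subset_Pow_vertices: "facets \<Delta> \<subseteq> Pow (vertices \<Delta>)"
  by (auto simp: facets_def vertices_def)

theorem theorem2p6:
  fixes \<Delta> :: "'a set set" and d n :: nat
    and V :: "'b set" and E :: "'b set set"
  shows "(simplicial_cplx \<Delta> \<and> card (vertices \<Delta>) = n \<and> pure_cplx \<Delta> \<and> cplx_dim \<Delta> = int d
      \<longrightarrow> (unit_interval_cplx d \<Delta> \<longleftrightarrow>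
            (\<exists>l. bij_betw l (vertices \<Delta>) {1..n} \<and>
              (\<forall>F\<in>relabel l (facets \<Delta>). \<forall>j. Min F \<le> j \<and> j \<le> Max F \<and> j \<notin> F \<longrightarrow>
                (\<forall>i\<in>F. (\<exists>H\<in>relabel l (facets \<Delta>). j \<in> H \<and> i \<in> H)
                    \<longrightarrow> insert j (F - {i}) \<in> relabel l (facets \<Delta>))))))
    \<and> (simple_graph V E \<longrightarrow> (closed_graph V E \<longleftrightarrow> proper_interval_graph V E))"
proof (intro conjI impI)
  assume "simplicial_cplx \<Delta> \<and> card (vertices \<Delta>) = n \<and> pure_cplx \<Delta> \<and> cplx_dim \<Delta> = int d"
  then have n: "card (vertices \<Delta>) = n" and card: "\<And>F. F \<in> facets \<Delta> \<Longrightarrow> card F = d + 1"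
    by (auto simp: pure_cplx_def face_dim_def)
  have card_relabel: "card F = d + 1" "finite F" "F \<noteq> {}"
    if "bij_betw l (vertices \<Delta>) {1..n}" "F \<in> relabel l (facets \<Delta>)" for l F
  proof -
    from that(2) obtain F0 where "F0 \<in> facets \<Delta>" "F = l ` F0" by (auto simp: relabel_def)
    moreover from this have "inj_on l F0"
      using that facets_subset_Pow_vertices by (metis PowD bij_betw_def inj_on_subset subsetD)
    ultimately show "card F = d + 1" using card by (simp add: card_image)
    then show "finite F" "F \<noteq> {}" by (auto intro: card_ge_0_finite)
  qed
  show "unit_interval_cplx d \<Delta> \<longleftrightarrow>
            (\<exists>l. bij_betw l (vertices \<Delta>) {1..n} \<and>
              (\<forall>F\<in>relabel l (facets \<Delta>). \<forall>j. Min F \<le> j \<and> j \<le> Max F \<and> j \<notin> F \<longrightarrow>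
                (\<forall>i\<in>F. (\<exists>H\<in>relabel l (facets \<Delta>). j \<in> H \<and> i \<in> H)
                    \<longrightarrow> insert j (F - {i}) \<in> relabel l (facets \<Delta>))))"
    (is "_ \<longleftrightarrow> (\<exists>l. ?exchange l)")
  proof
    assume "unit_interval_cplx d \<Delta>"
    then obtain l where l: "bij_betw l (vertices \<Delta>) {1..n}"
      and int: "\<And>F J. F \<in> relabel l (facets \<Delta>) \<Longrightarrow> card J = d + 1 \<Longrightarrow> J \<subseteq> {Min F..Max F}
                  \<Longrightarrow> J \<in> relabel l (facets \<Delta>)"
      unfolding unit_interval_cplx_def n by blast
    \<comment> \<open>The exchanged set again has \<open>d + 1\<close> elements and stays within the
      range of \<open>F\<close>.\<close>
    have "insert j (F - {i}) \<in> relabel l (facets \<Delta>)"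
      if "F \<in> relabel l (facets \<Delta>)" "Min F \<le> j" "j \<le> Max F" "j \<notin> F" "i \<in> F" for F i j
      using that card_relabel[OF l that(1)] by (intro int[OF that(1)]) (auto simp: card_Suc_Diff1)
    then show "\<exists>l. ?exchange l" using l by blast
  next
    assume "\<exists>l. ?exchange l"
    then obtain l where ex: "?exchange l" by (rule exE)
    then have l: "bij_betw l (vertices \<Delta>) {1..n}" by (rule conjunct1)
    have exch: "\<And>F H i j. F \<in> relabel l (facets \<Delta>) \<Longrightarrow> H \<in> relabel l (facets \<Delta>) \<Longrightarrow> Min F \<le> j
        \<Longrightarrow> j \<le> Max F \<Longrightarrow> j \<notin> F \<Longrightarrow> i \<in> F \<Longrightarrow> j \<in> H \<Longrightarrow> i \<in> H
        \<Longrightarrow> insert j (F - {i}) \<in> relabel l (facets \<Delta>)"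
      using ex[THEN conjunct2] by auto
    have sub: "relabel l (facets \<Delta>) \<subseteq> Pow {1..n}"
      using l facets_subset_Pow_vertices[of \<Delta>] by (fastforce simp: relabel_def bij_betw_def)
    \<comment> \<open>Here the vertex set is the label set \<open>{1..n}\<close>, so
      \<open>g\<close> permutes labels and \<open>g \<circ> l\<close> is the new labelling.\<close>
    obtain g where g: "bij_betw g {1..n} {1..card {1..n}}"
      and int: "\<And>F J. F \<in> relabel g (relabel l (facets \<Delta>)) \<Longrightarrow> card J = d + 1
        \<Longrightarrow> J \<subseteq> {Min F..Max F} \<Longrightarrow> J \<in> relabel g (relabel l (facets \<Delta>))"
      by (rule exchange_imp_interval_relabelling[OF finite_atLeastAtMost sub])
        (erule card_relabel(1)[OF l], (rule exch; assumption), (rule that; blast))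
    have "bij_betw (g \<circ> l) (vertices \<Delta>) {1..card (vertices \<Delta>)}"
      using bij_betw_trans[OF l g] n by simp
    then show "unit_interval_cplx d \<Delta>"
      unfolding unit_interval_cplx_def using int by (metis relabel_comp)
  qed
next
  assume "simple_graph V E"
  then show "closed_graph V E \<longleftrightarrow> proper_interval_graph V E"
    using closed_imp_proper_interval proper_interval_imp_closed by blast
qed

end
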